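(* Let $\mathcal C$ be a graph class. Then $\mathcal C$ has bounded degeneracy if and only if $\sup_{G\in\mathcal C}\mathrm{mw}_1(G)<\infty$ and there is $t\in\mathbb N$ such that no graph in $\mathcal C$ contains the biclique $K_{t,t}$ as a subgraph.
   Context: Graphs are finite, simple and undirected: $G=(V,E(G))$ with $E(G)\subseteq\binom V2$. Subgraphs are not necessarily induced. A graph is $d$-degenerate if its vertices admit a total order in which every vertex has at most $d$ neighbors before it; a class has bounded degeneracy if there is $d$ such that all its graphs are $d$-degenerate. Radius-1 merge-width. A construction sequence on $V$ is a sequence of steps maintaining a partition $\mathcal P$ of $V$ and a partition of $\binom V2$ into edges $E$, non-edges $N$, and unresolved pairs $U$. Initially $\mathcal P$ is the partition into singletons and $U=\binom V2$. In each step one of three operations is performed: merge two parts $A,B\in\mathcal P$, replacing them by $A\cup B$; resolve positively a pair of parts $A,B\in\mathcal P$ (possibly $A=B$), moving all $\{a,b\}\in U$ with $a\in A,b\in B$ from $U$ to $E$; or resolve negatively such a pair of parts, moving these pairs from $U$ to $N$. In the end $\mathcal P$ has one part and $U=\emptyset$; it is then a construction sequence of the graph $(V,E)$. Its radius-$1$ width is the least $k$ such that at every step, for every $v\in V$, at most $k$ parts of the current $\mathcal P$ contain a vertex equal or adjacent to $v$ in the graph $(V,E\cup N)$ for the current $E,N$. $\mathrm{mw}_1(G)$ is the least radius-$1$ width of a construction sequence of $G$. *)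

theory Defs
  imports Main "HOL-Library.Extended_Nat"
begin

definition all_pairs :: "'a set \<Rightarrow> 'a set set" where
  "all_pairs V = {e. e \<subseteq> V \<and> card e = 2}"

record 'a graph =
  verts :: "'a set"
  edges :: "'a set set"

definition simple_graph :: "'a graph \<Rightarrow> bool" where
  "simple_graph G \<longleftrightarrow> finite (verts G) \<and> edges G \<subseteq> all_pairs (verts G)"

definition contains_subgraph :: "'a graph \<Rightarrow> 'b graph \<Rightarrow> bool" where
  "contains_subgraph G H \<longleftrightarrow>
     (\<exists>f. inj_on f (verts H) \<and> f ` verts H \<subseteq> verts G \<and> (\<forall>e\<in>edges H. f ` e \<in> edges G))"

definition biclique :: "nat \<Rightarrow> (nat + nat) graph" where
  "biclique t = \<lparr> verts = {..<t} <+> {..<t},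
                 edges = {{Inl i, Inr j} | i j. i < t \<and> j < t} \<rparr>"

definition degenerate :: "nat \<Rightarrow> 'a graph \<Rightarrow> bool" where
  "degenerate d G \<longleftrightarrow>
     (\<exists>r. linear_order_on (verts G) r \<and>
       (\<forall>v\<in>verts G. card {u \<in> verts G. (u, v) \<in> r \<and> u \<noteq> v \<and> {u, v} \<in> edges G} \<le> d))"

definition bounded_degeneracy :: "'a graph set \<Rightarrow> bool" where
  "bounded_degeneracy \<C> \<longleftrightarrow> (\<exists>d. \<forall>G\<in>\<C>. degenerate d G)"

record 'a cstate =
  parts :: "'a set set"
  pos :: "'a set set"
  neg :: "'a set set"
  unres :: "'a set set"

definition initial_state :: "'a set \<Rightarrow> 'a cstate" where
  "initial_state V = \<lparr> parts = (\<lambda>v. {v}) ` V, pos = {}, neg = {}, unres = all_pairs V \<rparr>"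

definition unres_between :: "'a cstate \<Rightarrow> 'a set \<Rightarrow> 'a set \<Rightarrow> 'a set set" where
  "unres_between s A B = {e \<in> unres s. \<exists>a\<in>A. \<exists>b\<in>B. e = {a, b}}"

inductive cstep :: "'a cstate \<Rightarrow> 'a cstate \<Rightarrow> bool" where
  merge: "\<lbrakk>A \<in> parts s; B \<in> parts s; A \<noteq> B\<rbrakk>
    \<Longrightarrow> cstep s (s\<lparr> parts := insert (A \<union> B) (parts s - {A, B}) \<rparr>)"
| resolve_pos: "\<lbrakk>A \<in> parts s; B \<in> parts s\<rbrakk>
    \<Longrightarrow> cstep s (s\<lparr> pos := pos s \<union> unres_between s A B,
                    unres := unres s - unres_between s A B \<rparr>)"
| resolve_neg: "\<lbrakk>A \<in> parts s; B \<in> parts s\<rbrakk>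
    \<Longrightarrow> cstep s (s\<lparr> neg := neg s \<union> unres_between s A B,
                    unres := unres s - unres_between s A B \<rparr>)"

text \<open>A construction sequence is given by the list of its states, from the initial one to the
  final one. For a nonempty vertex set the states always have at least one part, so the
  condition \<open>card \<le> 1\<close> says that the final partition has exactly one part; the
  inequality only serves to give the graph without vertices, whose partition has no parts, a
  construction sequence as well.\<close>

definition construction_sequence :: "'a graph \<Rightarrow> 'a cstate list \<Rightarrow> bool" where
  "construction_sequence G ss \<longleftrightarrow>
     ss \<noteq> [] \<and> hd ss = initial_state (verts G) \<and> successively cstep ss \<and>
     card (parts (last ss)) \<le> 1 \<and> unres (last ss) = {} \<and> pos (last ss) = edges G"

definition seen_parts :: "'a cstate \<Rightarrow> 'a \<Rightarrow> 'a set set" where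
  "seen_parts s v = {A \<in> parts s. \<exists>u\<in>A. u = v \<or> {u, v} \<in> pos s \<union> neg s}"

definition radius1_width :: "'a set \<Rightarrow> 'a cstate list \<Rightarrow> nat" where
  "radius1_width V ss = (LEAST k. \<forall>s\<in>set ss. \<forall>v\<in>V. card (seen_parts s v) \<le> k)"

definition mw1 :: "'a graph \<Rightarrow> enat" where
  "mw1 G = (INF ss\<in>{ss. construction_sequence G ss}. enat (radius1_width (verts G) ss))"

end

theory Submission
  imports Defs
begin

text \<open>
  From degeneracy to small width. Fix an order in which every vertex has at most \<open>d\<close> earlier
  neighbours, and let a single growing part \<open>B\<close> swallow the vertices from last to first. A vertex
  enters \<open>B\<close> only after all its edges to earlier vertices have been resolved positively. Hence the
  edges resolved so far all meet \<open>B\<close> or the vertex \<open>v0\<close> being treated, and every vertex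
  sees only \<open>B\<close>, itself, \<open>v0\<close>, and at most \<open>d\<close> of its earlier neighbours: the width is at most \<open>d + 3\<close>
  (\<open>mw1_le_if_degenerate\<close>). Non-edges are resolved all at once, when \<open>B\<close> is everything. A biclique
  with sides of size \<open>d + 1\<close> cannot occur, since its last vertex would have \<open>d + 1\<close> earlier
  neighbours (\<open>degenerate_no_biclique\<close>).

  From small width to degeneracy. It suffices that every nonempty \<open>W \<subseteq> verts G\<close> has a vertex with few
  neighbours in \<open>W\<close> (\<open>degenerate_if_every_subset_has_low_degree\<close>), and this is
  \<open>low_degree_vertex\<close>. Take a construction sequence of width \<open>k\<close> and suppose that \<open>card W \<ge> t\<close>. Merging
  at most doubles the traces of the parts on \<open>W\<close>, so at the first moment when some part \<open>A\<close> meets \<open>W\<close>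
  in at least \<open>t\<close> vertices, every part meets \<open>W\<close> in at most \<open>2 * t\<close> vertices
  (\<open>exists_balanced_state\<close>). The parts seen from the vertices of \<open>A \<inter> W\<close> then cover at most
  \<open>2 * t * (k * (2 * t))\<close> vertices of \<open>W\<close>. Any other vertex \<open>b\<close> of \<open>W\<close> is still unresolved towards
  all of \<open>A \<inter> W\<close>; as \<open>A\<close> is never split again, all these pairs will be resolved in the same step and
  with the same sign (\<open>homogeneous_along\<close>). So \<open>b\<close> is adjacent to all of \<open>A \<inter> W\<close> or to none of it, and
  without \<open>K\<^sub>t\<^sub>,\<^sub>t\<close> fewer than \<open>t\<close> vertices are adjacent to all of it. Each vertex of \<open>A \<inter> W\<close>
  therefore has a bounded number of neighbours in \<open>W\<close>.
\<close>

section \<open>Finite linear orders and degeneracy\<close>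

lemma linear_order_finite_max:
  assumes lin: "linear_order_on V r" and "finite S" "S \<noteq> {}" "S \<subseteq> V"
  shows "\<exists>m\<in>S. \<forall>x\<in>S. (x, m) \<in> r"
  using assms(2-4)
proof (induction S rule: finite_ne_induct)
  case (singleton x)
  then show ?case using lin by (auto simp: order_on_defs refl_on_def)
next
  case (insert x S)
  then obtain m where m: "m \<in> S" "\<forall>y\<in>S. (y, m) \<in> r" by auto
  have xx: "(x, x) \<in> r" using lin insert.prems by (auto simp: order_on_defs refl_on_def)
  have "x \<noteq> m" using m insert by auto
  then have "(x, m) \<in> r \<or> (m, x) \<in> r"
    using lin insert.prems m(1) by (auto simp: order_on_defs total_on_def)
  then show ?case
  proof
    assume "(m, x) \<in> r"
    then have "\<forall>y\<in>insert x S. (y, x) \<in> r"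
      using m xx lin unfolding order_on_defs trans_def by blast
    then show ?thesis by blast
  qed (use m in blast)
qed

lemma linear_order_on_insert_max:
  assumes "linear_order_on V r" "v \<notin> V"
  shows "linear_order_on (insert v V) (r \<union> insert v V \<times> {v})"
proof -
  have r: "r \<subseteq> V \<times> V" "refl_on V r" "trans r" "antisym r" "total_on V r"
    using assms(1) by (auto simp: order_on_defs)
  let ?r = "r \<union> insert v V \<times> {v}"
  have "refl_on (insert v V) ?r" using r(2) by (auto simp: refl_on_def)
  moreover have "trans ?r" using r(1,3) assms(2) unfolding trans_def by blast
  moreover have "antisym ?r" using r(1,4) assms(2) unfolding antisym_def by blast
  moreover have "total_on (insert v V) ?r" using r(5) unfolding total_on_def by blast
  moreover have "?r \<subseteq> insert v V \<times> insert v V" using r(1) by blast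
  ultimately show ?thesis by (simp add: order_on_defs)
qed

text \<open>A vertex of low degree in the whole set goes last; the rest is ordered by induction.\<close>

lemma degenerate_if_every_subset_has_low_degree:
  assumes fin: "finite (verts G)"
    and low: "\<And>W. W \<subseteq> verts G \<Longrightarrow> W \<noteq> {} \<Longrightarrow> \<exists>v\<in>W. card {u \<in> W. {u, v} \<in> edges G} \<le> d"
  shows "degenerate d G"
proof -
  have "\<exists>r. linear_order_on W r \<and>
      (\<forall>v\<in>W. card {u \<in> W. (u, v) \<in> r \<and> u \<noteq> v \<and> {u, v} \<in> edges G} \<le> d)"
    if "finite W" "W \<subseteq> verts G" for W
    using that
  proof (induction W rule: finite_psubset_induct)
    case (psubset W)
    show ?case
    proof (cases "W = {}")
      case True
      have "linear_order_on {} ({} :: ('a \<times> 'a) set)" by simp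
      then show ?thesis using True by blast
    next
      case False
      then obtain v where v: "v \<in> W" "card {u \<in> W. {u, v} \<in> edges G} \<le> d"
        using low psubset.prems by blast
      have "W - {v} \<subset> W" "W - {v} \<subseteq> verts G" using v psubset.prems by auto
      from psubset.IH[OF this] obtain r where r: "linear_order_on (W - {v}) r"
        "\<forall>w\<in>W - {v}. card {u \<in> W - {v}. (u, w) \<in> r \<and> u \<noteq> w \<and> {u, w} \<in> edges G} \<le> d"
        by blast
      define r' where "r' = r \<union> W \<times> {v}"
      have W: "insert v (W - {v}) = W" using v by auto
      have "linear_order_on W r'"
        using linear_order_on_insert_max[OF r(1), of v] unfolding W r'_def by simp
      moreover have "card {u \<in> W. (u, w) \<in> r' \<and> u \<noteq> w \<and> {u, w} \<in> edges G} \<le> d"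
        if "w \<in> W" for w
      proof (cases "w = v")
        case True
        have "card {u \<in> W. (u, w) \<in> r' \<and> u \<noteq> w \<and> {u, w} \<in> edges G}
            \<le> card {u \<in> W. {u, v} \<in> edges G}"
          using psubset.hyps True by (intro card_mono) auto
        then show ?thesis using v by simp
      next
        case False
        have "r \<subseteq> (W - {v}) \<times> (W - {v})" using r(1) by (auto simp: order_on_defs refl_on_def)
        then have "{u \<in> W. (u, w) \<in> r' \<and> u \<noteq> w \<and> {u, w} \<in> edges G}
            = {u \<in> W - {v}. (u, w) \<in> r \<and> u \<noteq> w \<and> {u, w} \<in> edges G}"
          using False unfolding r'_def by auto
        then show ?thesis using r(2) that False by simp
      qed
      ultimately show ?thesis by blast
    qed
  qed
  then show ?thesis using fin unfolding degenerate_def by blast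
qed

section \<open>Bicliques\<close>

lemma contains_biclique_if_complete_sets:
  assumes "X \<subseteq> verts G" "Y \<subseteq> verts G" "X \<inter> Y = {}" "finite X" "finite Y"
    and "t \<le> card X" "t \<le> card Y"
    and "\<And>x y. x \<in> X \<Longrightarrow> y \<in> Y \<Longrightarrow> {x, y} \<in> edges G"
  shows "contains_subgraph G (biclique t)"
proof -
  obtain f where f: "f ` {..<t} \<subseteq> X" "inj_on f {..<t}"
    using assms card_le_inj[of "{..<t}" X] by auto
  obtain g where g: "g ` {..<t} \<subseteq> Y" "inj_on g {..<t}"
    using assms card_le_inj[of "{..<t}" Y] by auto
  have fg: "f i \<noteq> g j" if "i < t" "j < t" for i j using f g assms(3) that by blast
  have "inj_on (case_sum f g) ({..<t} <+> {..<t})"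
    using f(2) g(2) fg fg[symmetric] unfolding inj_on_def by (auto simp: Plus_def)
  moreover have "case_sum f g ` ({..<t} <+> {..<t}) \<subseteq> verts G"
    using f(1) g(1) assms(1,2) by (auto simp: Plus_def image_subset_iff)
  moreover have "{f i, g j} \<in> edges G" if "i < t" "j < t" for i j
    using f(1) g(1) assms(8) that by blast
  ultimately show ?thesis
    unfolding contains_subgraph_def biclique_def by (intro exI[of _ "case_sum f g"]) auto
qed

text \<open>The last of the biclique's vertices in a degeneracy order has the whole opposite side, that is
  \<open>d + 1\<close> vertices, among its earlier neighbours.\<close>

lemma degenerate_no_biclique:
  assumes fin: "finite (verts G)" and deg: "degenerate d G"
  shows "\<not> contains_subgraph G (biclique (Suc d))"
proof
  let ?D = "{..<Suc d}"
  assume "contains_subgraph G (biclique (Suc d))"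
  then obtain f where inj: "inj_on f (?D <+> ?D)" and im: "f ` (?D <+> ?D) \<subseteq> verts G"
    and f_edges: "\<forall>e\<in>edges (biclique (Suc d)). f ` e \<in> edges G"
    unfolding contains_subgraph_def biclique_def by auto
  have edge: "{f (Inl i), f (Inr j)} \<in> edges G" if "i \<in> ?D" "j \<in> ?D" for i j
  proof -
    have "{Inl i, Inr j} \<in> edges (biclique (Suc d))"
      using that unfolding biclique_def by auto
    then show ?thesis using f_edges by force
  qed
  obtain r where lin: "linear_order_on (verts G) r"
    and r: "\<And>v. v \<in> verts G \<Longrightarrow>
      card {u \<in> verts G. (u, v) \<in> r \<and> u \<noteq> v \<and> {u, v} \<in> edges G} \<le> d"
    using deg unfolding degenerate_def by blast
  have "finite (f ` (?D <+> ?D))" "f ` (?D <+> ?D) \<noteq> {}" by (auto simp: Plus_def)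
  from linear_order_finite_max[OF lin this im]
  obtain m where m: "m \<in> f ` (?D <+> ?D)" "\<forall>x\<in>f ` (?D <+> ?D). (x, m) \<in> r"
    by blast
  \<comment> \<open>\<open>X\<close> stands for the side opposite to \<open>m\<close>, whichever of the two that is.\<close>
  have contra: False if X: "X \<subseteq> ?D <+> ?D" "card X = Suc d" "\<And>x. x \<in> X \<Longrightarrow> f x \<noteq> m \<and> {f x, m} \<in> edges G"
    for X
  proof -
    have "f ` X \<subseteq> {u \<in> verts G. (u, m) \<in> r \<and> u \<noteq> m \<and> {u, m} \<in> edges G}"
      using subsetD[OF im imageI[OF subsetD[OF X(1)]]] m(2) X by blast
    then have "card (f ` X) \<le> card {u \<in> verts G. (u, m) \<in> r \<and> u \<noteq> m \<and> {u, m} \<in> edges G}"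
      using fin by (intro card_mono) auto
    also have "\<dots> \<le> d" using r[of m] m(1) im by blast
    finally have "card (f ` X) \<le> d" .
    moreover have "card (f ` X) = Suc d"
      using card_image[OF inj_on_subset[OF inj X(1)]] X(2) by simp
    ultimately show False by simp
  qed
  obtain p where p: "p \<in> ?D <+> ?D" "m = f p" using m by blast
  then show False
  proof (cases p)
    case (Inl i)
    show False
    proof (rule contra[of "Inr ` ?D"])
      fix x assume x: "x \<in> (Inr ` ?D :: (nat + nat) set)"
      then have "x \<noteq> p" "x \<in> ?D <+> ?D" using Inl by auto
      then have "f x \<noteq> m" using inj p by (metis inj_onD)
      moreover have "{f x, m} \<in> edges G"
        using x p Inl edge by (auto simp: insert_commute)
      ultimately show "f x \<noteq> m \<and> {f x, m} \<in> edges G" ..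
    qed (auto simp: card_image)
  next
    case (Inr j)
    show False
    proof (rule contra[of "Inl ` ?D"])
      fix x assume x: "x \<in> (Inl ` ?D :: (nat + nat) set)"
      then have "x \<noteq> p" "x \<in> ?D <+> ?D" using Inr by auto
      then have "f x \<noteq> m" using inj p by (metis inj_onD)
      moreover have "{f x, m} \<in> edges G"
        using x p Inr edge by auto
      ultimately show "f x \<noteq> m \<and> {f x, m} \<in> edges G" ..
    qed (auto simp: card_image)
  qed
qed

section \<open>A construction sequence from a degeneracy order\<close>

definition width_le :: "'a set \<Rightarrow> nat \<Rightarrow> 'a cstate \<Rightarrow> bool" where
  "width_le V k s \<longleftrightarrow> (\<forall>v\<in>V. card (seen_parts s v) \<le> k)"

definition cstep_le :: "'a set \<Rightarrow> nat \<Rightarrow> 'a cstate \<Rightarrow> 'a cstate \<Rightarrow> bool" where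
  "cstep_le V k s s' \<longleftrightarrow> cstep s s' \<and> width_le V k s'"

text \<open>The states passed through in the sweep over a degeneracy order: \<open>B\<close> is the part of the vertices
  already treated, all other vertices are singletons, and nothing has been resolved negatively.
  Removing \<open>{}\<close> lets the initial state be the case \<open>B = {}\<close>.\<close>

definition blob_state :: "'a set \<Rightarrow> 'a set \<Rightarrow> 'a set set \<Rightarrow> 'a cstate" where
  "blob_state V B F = \<lparr> parts = ({B} - {{}}) \<union> (\<lambda>v. {v}) ` (V - B),
     pos = F, neg = {}, unres = all_pairs V - F \<rparr>"

text \<open>Reachability by steps of bounded width composes by transitivity, which spares the bookkeeping of
  state lists; the list is only assembled here.\<close>

lemma construction_sequence_of_steps:
  assumes "rtranclp (cstep_le V k) s s'" "width_le V k s"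
  shows "\<exists>ss. ss \<noteq> [] \<and> hd ss = s \<and> last ss = s' \<and> successively cstep ss \<and>
    (\<forall>x\<in>set ss. width_le V k x)"
  using assms
proof (induction rule: rtranclp_induct)
  case base
  then show ?case by (intro exI[of _ "[s]"]) auto
next
  case (step y z)
  then obtain ss where ss: "ss \<noteq> []" "hd ss = s" "last ss = y" "successively cstep ss"
    "\<forall>x\<in>set ss. width_le V k x" by auto
  then show ?case using step.hyps(2)
    by (intro exI[of _ "ss @ [z]"]) (auto simp: successively_append_iff cstep_le_def)
qed

lemma mw1_le_if_steps:
  assumes "rtranclp (cstep_le (verts G) k) (initial_state (verts G)) s"
    and "width_le (verts G) k (initial_state (verts G))"
    and "card (parts s) \<le> 1" "unres s = {}" "pos s = edges G"
  shows "mw1 G \<le> enat k"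
proof -
  obtain ss where ss: "ss \<noteq> []" "hd ss = initial_state (verts G)" "last ss = s"
    "successively cstep ss" "\<forall>x\<in>set ss. width_le (verts G) k x"
    using construction_sequence_of_steps[OF assms(1,2)] by blast
  then have "construction_sequence G ss" using assms unfolding construction_sequence_def by simp
  then have "mw1 G \<le> enat (radius1_width (verts G) ss)"
    unfolding mw1_def by (intro INF_lower) simp
  also have "radius1_width (verts G) ss \<le> k"
    unfolding radius1_width_def using ss(5) by (intro Least_le) (auto simp: width_le_def)
  finally show ?thesis by simp
qed

lemma blob_state_resolve_edge:
  assumes "{u, v} \<in> all_pairs V" "u \<in> V - B" "v \<in> V - B"
  shows "cstep (blob_state V B F) (blob_state V B (insert {u, v} F))"
proof -
  let ?s = "blob_state V B F"
  have "cstep ?s (?s\<lparr> pos := pos ?s \<union> unres_between ?s {u} {v},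
                    unres := unres ?s - unres_between ?s {u} {v} \<rparr>)"
    using assms by (intro cstep.resolve_pos) (auto simp: blob_state_def)
  also have "?s\<lparr> pos := pos ?s \<union> unres_between ?s {u} {v},
                    unres := unres ?s - unres_between ?s {u} {v} \<rparr> = blob_state V B (insert {u, v} F)"
    using assms unfolding unres_between_def blob_state_def by auto
  finally show ?thesis .
qed

lemma blob_state_absorb:
  assumes "v \<in> V - B" "B \<subseteq> V" "B \<noteq> {}"
  shows "cstep (blob_state V B F) (blob_state V (insert v B) F)"
proof -
  let ?s = "blob_state V B F"
  have "cstep ?s (?s\<lparr> parts := insert ({v} \<union> B) (parts ?s - {{v}, B}) \<rparr>)"
    using assms by (intro cstep.merge) (auto simp: blob_state_def)
  also have "?s\<lparr> parts := insert ({v} \<union> B) (parts ?s - {{v}, B}) \<rparr> = blob_state V (insert v B) F"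
    using assms unfolding blob_state_def by auto
  finally show ?thesis .
qed

text \<open>The two parts beyond the neighbouring singletons are \<open>B\<close> and the singleton of \<open>v\<close>.\<close>

lemma blob_state_width:
  assumes fin: "finite V" and deg: "\<And>v. v \<in> V \<Longrightarrow> card {u \<in> V - B. {u, v} \<in> F} \<le> k + 1"
  shows "width_le V (k + 3) (blob_state V B F)"
  unfolding width_le_def
proof
  fix v assume v: "v \<in> V"
  let ?N = "{u \<in> V - B. {u, v} \<in> F}"
  have "seen_parts (blob_state V B F) v \<subseteq> insert B (insert {v} ((\<lambda>u. {u}) ` ?N))"
    unfolding seen_parts_def blob_state_def by auto
  then have "card (seen_parts (blob_state V B F) v) \<le> card (insert B (insert {v} ((\<lambda>u. {u}) ` ?N)))"
    using fin by (intro card_mono) auto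
  also have "\<dots> \<le> Suc (Suc (card ((\<lambda>u. {u}) ` ?N)))"
    by (intro card_insert_le_m1) simp_all
  also have "\<dots> \<le> Suc (Suc (card ?N))"
    using fin by (simp add: card_image_le)
  also have "\<dots> \<le> k + 3" using deg[OF v] by simp
  finally show "card (seen_parts (blob_state V B F) v) \<le> k + 3" .
qed

text \<open>The sweep from the last vertex to the first. Between two vertices the resolved edges are exactly
  \<open>EB B\<close>, those that meet the treated set \<open>B\<close>.\<close>

lemma mw1_le_if_degenerate:
  assumes simple: "simple_graph G" and deg: "degenerate d G"
  shows "mw1 G \<le> enat (d + 3)"
proof -
  define V E where "V = verts G" and "E = edges G"
  have fin: "finite V" and EV: "E \<subseteq> all_pairs V"
    using simple unfolding simple_graph_def V_def E_def by auto
  have finE: "finite E"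
    using fin EV by (intro finite_subset[of E "Pow V"]) (auto simp: all_pairs_def)
  obtain r where lin: "linear_order_on V r"
    and r: "\<And>v. v \<in> V \<Longrightarrow> card {u \<in> V. (u, v) \<in> r \<and> u \<noteq> v \<and> {u, v} \<in> E} \<le> d"
    using deg unfolding degenerate_def V_def E_def by blast
  have no_loop: "u \<noteq> v" if "{u, v} \<in> E" for u v using that EV by (auto simp: all_pairs_def)
  define EB where "EB B = {e \<in> E. e \<inter> B \<noteq> {}}" for B
  let ?R = "rtranclp (cstep_le V (d + 3))"
  \<comment> \<open>While \<open>v0\<close> is treated, \<open>insert v0 B\<close> is a final segment of the order. A vertex \<open>v\<close> joined by a
    resolved edge to an untreated \<open>u \<noteq> v0\<close> lies in that segment, so \<open>u\<close> precedes \<open>v\<close>.\<close>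
  have width: "width_le V (d + 3) (blob_state V B F)"
    if F: "F \<subseteq> EB (insert v0 B)" and v0: "v0 \<in> V - B"
      and last: "\<And>x y. x \<in> V - insert v0 B \<Longrightarrow> y \<in> insert v0 B \<Longrightarrow> (x, y) \<in> r" for B F v0
  proof -
    have "card {u \<in> V - B. {u, v} \<in> F} \<le> d + 1" if v: "v \<in> V" for v
    proof -
      let ?P = "{u \<in> V. (u, v) \<in> r \<and> u \<noteq> v \<and> {u, v} \<in> E}"
      have "{u \<in> V - B. {u, v} \<in> F} \<subseteq> insert v0 ?P"
      proof
        fix u assume "u \<in> {u \<in> V - B. {u, v} \<in> F}"
        then have u: "u \<in> V" "u \<notin> B" "{u, v} \<in> F" by auto
        then have e: "{u, v} \<in> E" "u \<in> insert v0 B \<or> v \<in> insert v0 B"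
          using F unfolding EB_def by auto
        then show "u \<in> insert v0 ?P" using u last no_loop by blast
      qed
      then have "card {u \<in> V - B. {u, v} \<in> F} \<le> card (insert v0 ?P)"
        using fin by (intro card_mono) auto
      also have "\<dots> \<le> Suc (card ?P)" using fin by (simp add: card_insert_if)
      finally show ?thesis using r[OF v] by simp
    qed
    from blob_state_width[OF fin this] show ?thesis .
  qed
  \<comment> \<open>Induction on the set \<open>P\<close> of untreated vertices, an initial segment of the order.\<close>
  have steps: "?R (blob_state V (V - P) (EB (V - P))) (blob_state V V E)"
    if "finite P" "P \<subseteq> V" "\<And>x y. x \<in> P \<Longrightarrow> y \<in> V - P \<Longrightarrow> (x, y) \<in> r" for P
    using that
  proof (induction P rule: finite_psubset_induct)
    case (psubset P)
    show ?case
    proof (cases "P = {}")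
      case True
      have "EB V = E" using EV unfolding EB_def by (auto simp: all_pairs_def card_2_iff)
      then show ?thesis using True by simp
    next
      case False
      obtain v where v: "v \<in> P" "\<And>x. x \<in> P \<Longrightarrow> (x, v) \<in> r"
        using linear_order_finite_max[OF lin psubset.hyps(1) False psubset.prems(1)] by blast
      define B where "B = V - P"
      have BP: "insert v B = V - (P - {v})" "v \<in> V - B" "B \<subseteq> V"
        using v psubset.prems(1) unfolding B_def by auto
      have last: "(x, y) \<in> r" if "x \<in> V - insert v B" "y \<in> insert v B" for x y
        using that v psubset.prems(2) unfolding B_def by blast
      have resolve: "?R (blob_state V B F) (blob_state V B (F \<union> S))"
        if "finite S" "F \<union> S \<subseteq> EB (insert v B)" "\<And>e. e \<in> S \<Longrightarrow> e \<inter> B = {}" for F S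
        using that
      proof (induction S rule: finite_induct)
        case empty
        then show ?case by simp
      next
        case (insert e S)
        have "e \<in> all_pairs V" using insert.prems EV unfolding EB_def by auto
        then obtain a b where e: "e = {a, b}" "e \<subseteq> V"
          unfolding all_pairs_def card_2_iff by auto
        have "cstep (blob_state V B (F \<union> S)) (blob_state V B (insert e (F \<union> S)))"
          using blob_state_resolve_edge[of a b V B] e \<open>e \<in> all_pairs V\<close> insert.prems(2)[of e] by auto
        moreover have "width_le V (d + 3) (blob_state V B (insert e (F \<union> S)))"
          using insert.prems(1) BP(2) last by (intro width[of _ v]) auto
        ultimately show ?case
          using insert.IH insert.prems by (auto simp: cstep_le_def intro: rtranclp.rtrancl_into_rtrancl)
      qed
      let ?S = "{e \<in> E. v \<in> e \<and> e \<inter> B = {}}"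
      have EBv: "EB B \<union> ?S = EB (insert v B)" unfolding EB_def by auto
      have "?R (blob_state V B (EB B)) (blob_state V B (EB B \<union> ?S))"
        by (rule resolve) (use finE EBv in auto)
      then have 1: "?R (blob_state V B (EB B)) (blob_state V B (EB (insert v B)))"
        unfolding EBv .
      have 3: "?R (blob_state V (insert v B) (EB (insert v B))) (blob_state V V E)"
        unfolding BP(1) using v psubset.prems last BP(1)
        by (intro psubset.IH) auto
      have 2: "?R (blob_state V B (EB (insert v B))) (blob_state V (insert v B) (EB (insert v B)))"
      proof (cases "B = {}")
        \<comment> \<open>The first vertex treated is already a singleton part, so there is nothing to merge.\<close>
        case True
        then have "blob_state V B F = blob_state V (insert v B) F" for F
          using BP(2) unfolding blob_state_def by auto
        then show ?thesis by simp
      next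
        case False
        have "width_le V (d + 3) (blob_state V (insert v B) (EB (insert v B)))"
        proof (cases "P - {v} = {}")
          case True
          then have "insert v B = V" using BP by auto
          then show ?thesis using blob_state_width[OF fin, of "V" "EB V" d] by simp
        next
          case ne: False
          \<comment> \<open>With \<open>w\<close> as the next vertex, \<open>EB (insert v B)\<close> is a special case of the states met
            while \<open>w\<close> is treated.\<close>
          obtain w where w: "w \<in> P - {v}" "\<And>x. x \<in> P - {v} \<Longrightarrow> (x, w) \<in> r"
            using linear_order_finite_max[OF lin _ ne] psubset.hyps psubset.prems(1) by blast
          show ?thesis
          proof (rule width[of _ w])
            show "EB (insert v B) \<subseteq> EB (insert w (insert v B))" unfolding EB_def by auto
            show "w \<in> V - insert v B" using w BP psubset.prems(1) by auto
            fix x y assume "x \<in> V - insert w (insert v B)" "y \<in> insert w (insert v B)"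
            then show "(x, y) \<in> r" using w last BP by auto
          qed
        qed
        then have "cstep_le V (d + 3) (blob_state V B (EB (insert v B)))
            (blob_state V (insert v B) (EB (insert v B)))"
          using blob_state_absorb[OF BP(2,3) False] unfolding cstep_le_def by blast
        then show ?thesis by blast
      qed
      show ?thesis using 1 2 3 unfolding B_def[symmetric] by (meson rtranclp_trans)
    qed
  qed
  have init: "initial_state V = blob_state V {} {}"
    unfolding initial_state_def blob_state_def by simp
  have w0: "width_le V (d + 3) (initial_state V)"
    unfolding init using blob_state_width[OF fin, of "{}" "{}" d] by simp
  have "EB {} = {}" unfolding EB_def by auto
  then have run: "?R (initial_state V) (blob_state V V E)"
    using steps[of V] fin init by simp
  show ?thesis
  proof (cases "V = {}")
    case True
    then have "E = {}" "all_pairs V = {}" using EV by (auto simp: all_pairs_def)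
    then show ?thesis
      using w0 True unfolding V_def E_def
      by (intro mw1_le_if_steps[where s = "initial_state (verts G)"]) (auto simp: initial_state_def)
  next
    case False
    let ?s = "blob_state V V E"
    let ?f = "\<lparr> parts = {V}, pos = E, neg = all_pairs V - E, unres = {} \<rparr>"
    have "unres_between ?s V V = all_pairs V - E"
      unfolding unres_between_def blob_state_def all_pairs_def card_2_iff by fastforce
    then have "?s\<lparr> neg := neg ?s \<union> unres_between ?s V V,
                    unres := unres ?s - unres_between ?s V V \<rparr> = ?f"
      using False by (auto simp: blob_state_def)
    moreover have "cstep ?s (?s\<lparr> neg := neg ?s \<union> unres_between ?s V V,
                    unres := unres ?s - unres_between ?s V V \<rparr>)"
      using False by (intro cstep.resolve_neg) (auto simp: blob_state_def)
    ultimately have "cstep ?s ?f" by simp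
    moreover have "width_le V (d + 3) ?f"
    proof -
      have "card (seen_parts ?f v) \<le> card {V}" for v
        by (intro card_mono) (auto simp: seen_parts_def)
      moreover have "card {V} \<le> d + 3" by simp
      ultimately show ?thesis unfolding width_le_def by (meson order_trans)
    qed
    ultimately have "?R (initial_state V) ?f"
      using run by (auto simp: cstep_le_def intro: rtranclp.rtrancl_into_rtrancl)
    then show ?thesis
      using w0 unfolding V_def E_def by (intro mw1_le_if_steps) auto
  qed
qed

section \<open>Invariants of construction sequences\<close>

definition consistent_state :: "'a set \<Rightarrow> 'a cstate \<Rightarrow> bool" where
  "consistent_state V s \<longleftrightarrow>
     \<Union> (parts s) = V \<and> pairwise disjnt (parts s) \<and>
     pos s \<inter> unres s = {} \<and> all_pairs V \<subseteq> pos s \<union> neg s \<union> unres s"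

lemma consistent_initial_state: "consistent_state V (initial_state V)"
  unfolding consistent_state_def initial_state_def by (auto simp: pairwise_def)

lemma consistent_state_step:
  assumes "cstep s s'" "consistent_state V s"
  shows "consistent_state V s'"
  using assms
proof cases
  case (merge A B)
  have "pairwise disjnt (insert (A \<union> B) (parts s - {A, B}))"
    using assms(2) merge unfolding consistent_state_def
    by (auto simp: pairwise_insert pairwise_def disjnt_Un1 disjnt_Un2)
  then show ?thesis using assms(2) merge unfolding consistent_state_def by auto
qed (auto simp: consistent_state_def unres_between_def)

text \<open>The pairs between \<open>A\<close> and \<open>b\<close> are in the same situation, and stay so because \<open>A\<close> lies inside one
  part. In a final state this says that \<open>b\<close> is adjacent to all of \<open>A\<close> or to none of it.\<close>

definition homogeneous_in :: "'a set \<Rightarrow> 'a \<Rightarrow> 'a cstate \<Rightarrow> bool" where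
  "homogeneous_in A b s \<longleftrightarrow>
     (\<exists>C\<in>parts s. A \<subseteq> C) \<and> (\<exists>D\<in>parts s. b \<in> D) \<and>
     (let P = (\<lambda>a. {a, b}) ` A in
        (P \<subseteq> unres s \<or> P \<inter> unres s = {}) \<and> (P \<subseteq> pos s \<or> P \<inter> pos s = {}))"

text \<open>Parts are disjoint, so resolving two parts touches a pair between \<open>A\<close> and \<open>b\<close> only if they are
  the parts that contain \<open>A\<close> and \<open>b\<close>, and then it touches every unresolved such pair.\<close>

lemma homogeneous_step:
  assumes step: "cstep s s'" and cons: "consistent_state V s" and hom: "homogeneous_in A b s"
  shows "homogeneous_in A b s'"
proof -
  define P where "P = (\<lambda>a. {a, b}) ` A"
  obtain C D where CD: "C \<in> parts s" "A \<subseteq> C" "D \<in> parts s" "b \<in> D"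
    and P: "P \<subseteq> unres s \<or> P \<inter> unres s = {}" "P \<subseteq> pos s \<or> P \<inter> pos s = {}"
    using hom unfolding homogeneous_in_def Let_def P_def[symmetric] by auto
  have pd: "X = Y" if "X \<in> parts s" "Y \<in> parts s" "x \<in> X" "x \<in> Y" for X Y x
    using cons that unfolding consistent_state_def pairwise_def disjnt_def by blast
  have between: "P \<subseteq> unres_between s X Y \<or> P \<inter> unres_between s X Y = {}"
    if XY: "X \<in> parts s" "Y \<in> parts s" for X Y
  proof (cases "P \<subseteq> unres s")
    case True
    show ?thesis
    proof (cases "(C = X \<and> D = Y) \<or> (C = Y \<and> D = X)")
      case CDXY: True
      have "{a, b} \<in> unres_between s X Y" if "a \<in> A" for a
        using CDXY CD that True unfolding unres_between_def P_def
        by (auto simp: insert_commute)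
      then show ?thesis unfolding P_def by blast
    next
      case False
      have "{a, b} \<notin> unres_between s X Y" if "a \<in> A" for a
        using False CD that XY pd unfolding unres_between_def
        by (auto simp: doubleton_eq_iff)
      then show ?thesis unfolding P_def by blast
    qed
  qed (use P(1) in \<open>auto simp: unres_between_def\<close>)
  have PU: "P \<subseteq> unres s \<Longrightarrow> P \<inter> pos s = {}"
    using cons unfolding consistent_state_def by blast
  have sub: "unres_between s X Y \<subseteq> unres s" for X Y unfolding unres_between_def by blast
  show ?thesis
    using step
  proof cases
    case (merge X Y)
    have "\<exists>C\<in>parts s'. A \<subseteq> C" "\<exists>D\<in>parts s'. b \<in> D"
      using CD merge by auto
    then show ?thesis using P merge unfolding homogeneous_in_def Let_def P_def[symmetric] by simp
  next
    case (resolve_pos X Y)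
    then show ?thesis
      using between[of X Y] P PU sub[of X Y] CD
      unfolding homogeneous_in_def Let_def P_def[symmetric] by (simp; blast)
  next
    case (resolve_neg X Y)
    then show ?thesis
      using between[of X Y] P PU sub[of X Y] CD
      unfolding homogeneous_in_def Let_def P_def[symmetric] by (simp; blast)
  qed
qed

lemma consistent_along:
  assumes "successively cstep ss" "ss \<noteq> []" "consistent_state V (hd ss)" "s \<in> set ss"
  shows "consistent_state V s"
  using assms
proof (induction ss)
  case (Cons x ss)
  then show ?case
    using consistent_state_step[of x "hd ss" V] by (cases "ss = []") (auto simp: successively_Cons)
qed simp

lemma homogeneous_along:
  assumes "successively cstep ss" "ss \<noteq> []" "consistent_state V (hd ss)"
    "homogeneous_in A b (hd ss)"
  shows "homogeneous_in A b (last ss)"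
  using assms
proof (induction ss)
  case (Cons s ss)
  show ?case
  proof (cases "ss = []")
    case False
    then have st: "cstep s (hd ss)" "successively cstep ss"
      using Cons.prems(1) by (auto simp: successively_Cons)
    show ?thesis
      using Cons.IH[OF st(2) False] consistent_state_step[OF st(1), of V]
        homogeneous_step[OF st(1), of V A b] Cons.prems False by auto
  qed (use Cons.prems in auto)
qed simp

section \<open>Low degrees from small width and no biclique\<close>

lemma cstep_doubles_parts:
  assumes "cstep s s'" "\<And>A. A \<in> parts s \<Longrightarrow> card (A \<inter> W) \<le> t" "A \<in> parts s'"
  shows "card (A \<inter> W) \<le> 2 * t"
  using assms(1)
proof cases
  case (merge X Y)
  have "card ((X \<union> Y) \<inter> W) \<le> card (X \<inter> W) + card (Y \<inter> W)"
    by (simp add: Int_Un_distrib2 card_Un_le)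
  then show ?thesis using assms(2)[of X] assms(2)[of Y] assms(2)[of A] assms(3) merge by auto
qed (use assms(2)[of A] assms(3) in auto)

text \<open>Take the first state with a part of trace at least \<open>t\<close>. Unless it is the initial one, all traces
  were below \<open>t\<close> one step earlier, and a merge at most doubles them.\<close>

lemma exists_balanced_state:
  assumes "successively cstep ss" "ss \<noteq> []"
    and "\<And>A. A \<in> parts (hd ss) \<Longrightarrow> card (A \<inter> W) \<le> 2 * t"
    and "\<exists>A\<in>parts (last ss). t \<le> card (A \<inter> W)"
  shows "\<exists>xs s ys. ss = xs @ s # ys \<and> (\<forall>A\<in>parts s. card (A \<inter> W) \<le> 2 * t) \<and>
    (\<exists>A\<in>parts s. t \<le> card (A \<inter> W))"
  using assms
proof (induction ss)
  case (Cons s ss)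
  show ?case
  proof (cases "\<exists>A\<in>parts s. t \<le> card (A \<inter> W)")
    case True
    then show ?thesis using Cons.prems(3) by (intro exI[of _ "[]"] exI[of _ s] exI[of _ ss]) auto
  next
    case False
    then have ne: "ss \<noteq> []" using Cons.prems(4) by auto
    then have st: "cstep s (hd ss)" "successively cstep ss"
      using Cons.prems(1) by (auto simp: successively_Cons)
    have "card (A \<inter> W) \<le> 2 * t" if "A \<in> parts (hd ss)" for A
      using cstep_doubles_parts[OF st(1) _ that] False by (meson nat_le_linear)
    then obtain xs s' ys where "ss = xs @ s' # ys" "\<forall>A\<in>parts s'. card (A \<inter> W) \<le> 2 * t"
      "\<exists>A\<in>parts s'. t \<le> card (A \<inter> W)"
      using Cons.IH[OF st(2) ne] Cons.prems(4) ne by auto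
    then show ?thesis by (intro exI[of _ "s # xs"] exI[of _ s'] exI[of _ ys]) auto
  qed
qed simp

text \<open>The infimum of extended naturals is attained, and the least width bound is a bound because the
  finitely many counts have a maximum.\<close>

lemma bounded_width_construction:
  assumes "finite (verts G)" "mw1 G \<le> enat k"
  shows "\<exists>ss. construction_sequence G ss \<and> (\<forall>s\<in>set ss. width_le (verts G) k s)"
proof -
  have "mw1 G < enat (Suc k)" using assms(2) by (simp add: order_le_less_trans)
  then obtain ss where ss: "construction_sequence G ss"
    "enat (radius1_width (verts G) ss) < enat (Suc k)"
    unfolding mw1_def INF_less_iff by blast
  let ?I = "(\<lambda>(s, v). card (seen_parts s v)) ` (set ss \<times> verts G)"
  have "\<forall>s\<in>set ss. \<forall>v\<in>verts G. card (seen_parts s v) \<le> Max ?I"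
    using assms(1) by (auto intro!: Max_ge)
  then have "\<forall>s\<in>set ss. \<forall>v\<in>verts G. card (seen_parts s v) \<le> radius1_width (verts G) ss"
    unfolding radius1_width_def by (rule LeastI)
  then show ?thesis using ss unfolding width_le_def by fastforce
qed

text \<open>The neighbours in \<open>W\<close> of a vertex of \<open>A \<inter> W\<close>, where \<open>A\<close> is the part with a large trace in the
  balanced state, split into those in a part seen from \<open>A \<inter> W\<close>, which the width controls, and those
  adjacent to all of \<open>A \<inter> W\<close>, of which the excluded biclique leaves fewer than \<open>t\<close>.\<close>

lemma low_degree_vertex:
  assumes simple: "simple_graph G" and mw: "mw1 G \<le> enat k"
    and nob: "\<not> contains_subgraph G (biclique t)"
    and W: "W \<subseteq> verts G" "W \<noteq> {}"
  shows "\<exists>v\<in>W. card {u \<in> W. {u, v} \<in> edges G} \<le> 2 * t * (k * (2 * t)) + t"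
proof -
  let ?V = "verts G"
  have fin: "finite ?V" and EV: "edges G \<subseteq> all_pairs ?V"
    using simple unfolding simple_graph_def by auto
  have finW: "finite W" using fin W finite_subset by blast
  have t: "0 < t"
  proof (rule ccontr)
    assume "\<not> 0 < t"
    then have "contains_subgraph G (biclique t)"
      unfolding contains_subgraph_def biclique_def by (auto simp: Plus_def)
    then show False using nob by simp
  qed
  show ?thesis
  proof (cases "card W < t")
    case True
    obtain v where "v \<in> W" using W by blast
    moreover have "card {u \<in> W. {u, v} \<in> edges G} \<le> card W"
      using finW by (intro card_mono) auto
    ultimately show ?thesis using True by (intro bexI[of _ v]) auto
  next
    case False
    obtain ss where cs: "construction_sequence G ss"
      and wd: "\<And>s. s \<in> set ss \<Longrightarrow> width_le ?V k s"
      using bounded_width_construction[OF fin mw] by blast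
    have ss: "successively cstep ss" "ss \<noteq> []" "hd ss = initial_state ?V"
      "card (parts (last ss)) \<le> 1" "pos (last ss) = edges G"
      using cs unfolding construction_sequence_def by auto
    have cons: "consistent_state ?V s" if "s \<in> set ss" for s
      using consistent_along[OF ss(1,2) _ that] ss(3) consistent_initial_state by metis
    have "\<Union> (parts (last ss)) = ?V" using cons[of "last ss"] ss(2) unfolding consistent_state_def by simp
    moreover have "finite (parts (last ss))"
      using calculation fin by (metis finite_UnionD)
    ultimately have "\<exists>C\<in>parts (last ss). C = ?V"
      using ss(4) W Union_upper[of _ "parts (last ss)"] card_le_Suc0_iff_eq[of "parts (last ss)"]
      by (metis One_nat_def Union_iff subsetI subset_antisym subset_empty)
    then have "\<exists>A\<in>parts (last ss). t \<le> card (A \<inter> W)"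
      using False W by (metis Int_absorb1 not_less)
    moreover have "card (A \<inter> W) \<le> 2 * t" if "A \<in> parts (hd ss)" for A
    proof -
      have "A \<in> (\<lambda>v. {v}) ` ?V" using that unfolding ss(3) initial_state_def by simp
      then obtain x where "A = {x}" by blast
      then have "card (A \<inter> W) \<le> card {x}" by (intro card_mono) auto
      then show ?thesis using t by simp
    qed
    ultimately obtain xs s ys A where s: "ss = xs @ s # ys"
      "\<And>A. A \<in> parts s \<Longrightarrow> card (A \<inter> W) \<le> 2 * t" and A: "A \<in> parts s" "t \<le> card (A \<inter> W)"
      using exists_balanced_state[OF ss(1,2)] by metis
    have "s \<in> set ss" using s(1) by simp
    note cons_s = cons[OF this] and wd_s = wd[OF this]
    have finparts: "finite (parts s)"
      using cons_s fin unfolding consistent_state_def by (metis finite_UnionD)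
    let ?A = "A \<inter> W"
    define R where "R a = \<Union> (seen_parts s a) \<inter> W" for a
    define Y where "Y = {b \<in> W. \<forall>a\<in>?A. {a, b} \<in> edges G}"
    obtain a where a: "a \<in> ?A" using A(2) t by (metis card.empty ex_in_conv not_less)
    \<comment> \<open>\<open>R x\<close> contains \<open>x\<close> and all vertices of \<open>W\<close> with a resolved pair to \<open>x\<close>; the vertices of \<open>Y\<close>
      are those adjacent to the whole trace.\<close>
    have cardR: "card (R x) \<le> k * (2 * t)" if "x \<in> W" for x
    proof -
      have "R x = (\<Union>C\<in>seen_parts s x. C \<inter> W)" unfolding R_def by auto
      also have "card \<dots> \<le> (\<Sum>C\<in>seen_parts s x. card (C \<inter> W))"
        using finparts by (intro card_UN_le) (auto simp: seen_parts_def)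
      also have "\<dots> \<le> card (seen_parts s x) * (2 * t)"
        using s(2) by (intro sum_bounded_above[where 'a = nat, simplified]) (auto simp: seen_parts_def)
      also have "\<dots> \<le> k * (2 * t)"
        using wd_s W(1) that unfolding width_le_def by (intro mult_right_mono) auto
      finally show ?thesis .
    qed
    have nbr: "{u \<in> W. {u, a} \<in> edges G} \<subseteq> (\<Union>x\<in>?A. R x) \<union> Y"
    proof
      fix b assume "b \<in> {u \<in> W. {u, a} \<in> edges G}"
      then have b: "b \<in> W" "{a, b} \<in> edges G" by (auto simp: insert_commute)
      show "b \<in> (\<Union>x\<in>?A. R x) \<union> Y"
      proof (cases "b \<in> (\<Union>x\<in>?A. R x)")
        case False
        obtain D where D: "D \<in> parts s" "b \<in> D"
          using cons_s b W(1) unfolding consistent_state_def by blast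
        have pairs: "{x, b} \<in> unres s" if x: "x \<in> ?A" for x
        proof -
          have "D \<notin> seen_parts s x" using False x D b unfolding R_def by auto
          then have "b \<noteq> x" "{x, b} \<notin> pos s \<union> neg s"
            using D unfolding seen_parts_def by (auto simp: insert_commute)
          moreover have "{x, b} \<in> all_pairs ?V"
            using x b W(1) \<open>b \<noteq> x\<close> unfolding all_pairs_def by auto
          ultimately show ?thesis using cons_s unfolding consistent_state_def by blast
        qed
        have "homogeneous_in ?A b s"
          using pairs A(1) D cons_s unfolding homogeneous_in_def consistent_state_def Let_def by blast
        moreover have "successively cstep (s # ys)"
          using ss(1) s(1) by (simp add: successively_append_iff)
        ultimately have "homogeneous_in ?A b (last (s # ys))"
          using cons_s by (intro homogeneous_along) auto
        then have "homogeneous_in ?A b (last ss)" using s(1) by simp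
        then have "{x, b} \<in> edges G" if "x \<in> ?A" for x
          using that a b(2) ss(5) unfolding homogeneous_in_def Let_def by blast
        then show ?thesis using b unfolding Y_def by blast
      qed simp
    qed
    have "card Y < t"
    proof (rule ccontr)
      assume "\<not> card Y < t"
      moreover have "?A \<inter> Y = {}"
        using EV unfolding Y_def all_pairs_def by (fastforce simp: card_2_iff)
      ultimately have "contains_subgraph G (biclique t)"
        using A(2) W(1) finW
        by (intro contains_biclique_if_complete_sets[of ?A G Y]) (auto simp: Y_def)
      then show False using nob by simp
    qed
    moreover have "card (\<Union>x\<in>?A. R x) \<le> 2 * t * (k * (2 * t))"
    proof -
      have "card (\<Union>x\<in>?A. R x) \<le> (\<Sum>x\<in>?A. card (R x))"
        using finW by (intro card_UN_le) auto
      also have "\<dots> \<le> card ?A * (k * (2 * t))"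
        using cardR by (intro sum_bounded_above[where 'a = nat, simplified]) auto
      also have "\<dots> \<le> 2 * t * (k * (2 * t))" using s(2)[OF A(1)] by (intro mult_right_mono) auto
      finally show ?thesis .
    qed
    moreover have "card {u \<in> W. {u, a} \<in> edges G} \<le> card ((\<Union>x\<in>?A. R x) \<union> Y)"
      using nbr finW by (intro card_mono) (auto simp: R_def Y_def)
    moreover have "card ((\<Union>x\<in>?A. R x) \<union> Y) \<le> card (\<Union>x\<in>?A. R x) + card Y"
      by (rule card_Un_le)
    ultimately show ?thesis using a by (intro bexI[of _ a]) auto
  qed
qed

section \<open>Equivalence of the two conditions\<close>

theorem corollary7p7:
  fixes \<C> :: "'a graph set"
  assumes "\<And>G. G \<in> \<C> \<Longrightarrow> simple_graph G"
  shows "bounded_degeneracy \<C> \<longleftrightarrow>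
    (SUP G\<in>\<C>. mw1 G) < \<infinity> \<and> (\<exists>t. \<forall>G\<in>\<C>. \<not> contains_subgraph G (biclique t))"
proof
  assume "bounded_degeneracy \<C>"
  then obtain d where d: "\<And>G. G \<in> \<C> \<Longrightarrow> degenerate d G"
    unfolding bounded_degeneracy_def by blast
  have "(SUP G\<in>\<C>. mw1 G) \<le> enat (d + 3)"
    using mw1_le_if_degenerate assms d by (intro SUP_least) blast
  then have "(SUP G\<in>\<C>. mw1 G) < \<infinity>" using order_le_less_trans enat_ord_simps(4) by blast
  moreover have "\<not> contains_subgraph G (biclique (Suc d))" if "G \<in> \<C>" for G
    using degenerate_no_biclique assms d that unfolding simple_graph_def by blast
  ultimately show "(SUP G\<in>\<C>. mw1 G) < \<infinity> \<and> (\<exists>t. \<forall>G\<in>\<C>. \<not> contains_subgraph G (biclique t))"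
    by blast
next
  assume R: "(SUP G\<in>\<C>. mw1 G) < \<infinity> \<and> (\<exists>t. \<forall>G\<in>\<C>. \<not> contains_subgraph G (biclique t))"
  then obtain k t where k: "(SUP G\<in>\<C>. mw1 G) = enat k"
    and t: "\<And>G. G \<in> \<C> \<Longrightarrow> \<not> contains_subgraph G (biclique t)"
    by (metis less_infinityE)
  have "degenerate (2 * t * (k * (2 * t)) + t) G" if G: "G \<in> \<C>" for G
  proof (rule degenerate_if_every_subset_has_low_degree)
    show "finite (verts G)" using assms G unfolding simple_graph_def by blast
    have "mw1 G \<le> enat k" using k G by (metis SUP_upper)
    then show "\<exists>v\<in>W. card {u \<in> W. {u, v} \<in> edges G} \<le> 2 * t * (k * (2 * t)) + t"
      if "W \<subseteq> verts G" "W \<noteq> {}" for W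
      using low_degree_vertex assms t G that by blast
  qed
  then show "bounded_degeneracy \<C>" unfolding bounded_degeneracy_def by blast
qed

end
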